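(* Let $n\ge 1$ be an integer and let $m=2n+1$. The group $\mathrm{GL}_2(\mathbb{R})$ acts transitively on the set of uniform balanced configurations of $m$ vectors of $\mathbb{R}^2$.
   Context: A configuration of $m$ vectors is a set $\{v_1,\dots,v_m\}$ of $m$ vectors of $\mathbb{R}^2$. It is balanced if for every $i\in\{1,\dots,m\}$ and every $x\in\mathbb{R}$, the number of indices $j\neq i$ with $\det(v_i,v_j)=x$ equals the number of indices $j\neq i$ with $\det(v_i,v_j)=-x$. A balanced configuration is uniform if for every pair $i\neq j$ the vectors $v_i,v_j$ are linearly independent. The group $\mathrm{GL}_2(\mathbb{R})$ acts on uniform balanced configurations of $m$ vectors by $g\cdot\{v_1,\dots,v_m\}=\{g v_1,\dots,g v_m\}$; this preserves balancedness and uniformity since $\det(gv_i,gv_j)=\det(g)\det(v_i,v_j)$. *)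

theory Defs
  imports "HOL-Analysis.Analysis" "HOL-Algebra.Group_Action"
begin

text \<open>The vectors are the rows of the matrix; by \<open>det_transpose\<close> it makes no difference
  that the literature usually takes them as columns.\<close>

definition det2 :: "real ^ 2 \<Rightarrow> real ^ 2 \<Rightarrow> real" where
  "det2 v w = det (vector [v, w] :: real ^ 2 ^ 2)"

definition configuration :: "nat \<Rightarrow> (real ^ 2) set \<Rightarrow> bool" where
  "configuration m V \<longleftrightarrow> finite V \<and> card V = m"

text \<open>A configuration is a set of \<open>m\<close> distinct vectors, so indices \<open>j \<noteq> i\<close> become elements
  \<open>w \<in> V - {v}\<close>.\<close>

definition balanced :: "(real ^ 2) set \<Rightarrow> bool" where
  "balanced V \<longleftrightarrow>
     (\<forall>v\<in>V. \<forall>x::real. card {w \<in> V - {v}. det2 v w = x} = card {w \<in> V - {v}. det2 v w = - x})"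

definition uniform :: "(real ^ 2) set \<Rightarrow> bool" where
  "uniform V \<longleftrightarrow> (\<forall>v\<in>V. \<forall>w\<in>V. v \<noteq> w \<longrightarrow> independent {v, w})"

definition uniform_balanced_configurations :: "nat \<Rightarrow> (real ^ 2) set set" where
  "uniform_balanced_configurations m = {V. configuration m V \<and> balanced V \<and> uniform V}"

definition GL2 :: "(real ^ 2 ^ 2) monoid" where
  "GL2 = \<lparr>carrier = {A. invertible A}, mult = (**), one = mat 1\<rparr>"

text \<open>The action is restricted to the given set because elements of \<open>BijGroup E\<close> are
  extensional functions on \<open>E\<close>.\<close>

definition GL2_action :: "(real ^ 2) set set \<Rightarrow> real ^ 2 ^ 2 \<Rightarrow> (real ^ 2) set \<Rightarrow> (real ^ 2) set" where
  "GL2_action E g = (\<lambda>V\<in>E. (\<lambda>v. g *v v) ` V)"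

end

theory Submission imports Defs begin

text \<open>
  Let \<open>V\<close> be a uniform balanced configuration of \<open>2 * n + 1\<close> vectors. Up to a linear map, \<open>V\<close> turns
  out to be the vertex set of a regular polygon. The proof has an algebraic half, which finds many
  linear relations between the vectors, and an order-theoretic half, which reads these relations as
  a second-order linear recurrence.

  \<^emph>\<open>Algebra.\<close> Balancedness at \<open>v\<close> says that every odd power sum of the numbers
  \<open>det2 v a\<close>, for \<open>a\<close> in \<open>V\<close>, vanishes. So for odd \<open>k\<close> the binary form
  \<open>x \<mapsto> (\<Sum>a\<in>V. det2 x a ^ k)\<close> of degree \<open>k\<close> has the \<open>2 * n + 1\<close> distinct lines of \<open>V\<close> among its
  zeros, and for \<open>k < 2 * n\<close> it must be zero identically. Evaluate it at \<open>x = v + w\<close> for two members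
  of \<open>V\<close>: the contributions of \<open>v\<close> and \<open>w\<close> cancel, so \<open>2 * n - 1\<close> numbers remain whose odd power
  sums up to order \<open>2 * n - 1\<close> vanish. By Newton's identities their product is zero. Therefore
  \<open>v + w\<close> is parallel to some \<open>u\<close> in \<open>V\<close> (lemma \<open>sum_parallel_third\<close>). For fixed \<open>v\<close>, balancedness
  makes the map \<open>w \<mapsto> u\<close> surjective, hence bijective, on the finite set \<open>V - {v}\<close>
  (lemma \<open>partner_unique\<close>).

  \<^emph>\<open>Order.\<close> As there are equally many vectors on both sides of each of the lines, the members of
  \<open>V\<close> and their opposites alternate around the origin. So there is an enumeration \<open>u\<close> by increasing
  angle, with \<open>u (t + (2 * n + 1)) = - u t\<close>, such that the members of \<open>V\<close> are the vectors
  \<open>(- 1) ^ t *\<^sub>R u t\<close> (lemma \<open>alternating_enumeration\<close>). The vector \<open>u t + u (t + 2)\<close> lies strictly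
  between its summands, and only \<open>u (t + 1)\<close> is available there as a parallel vector. For
  \<open>u t + u (t + 4)\<close> there are three candidates, and uniqueness of partners leaves only the middle
  one. These two facts give \<open>u (t + 2) = b *\<^sub>R u (t + 1) - u t\<close> with a coefficient that has period 2
  and, as \<open>u\<close> changes only its sign, also the odd period \<open>2 * n + 1\<close>; so \<open>b\<close> is constant
  (lemma \<open>three_term_recurrence\<close>).

  \<^emph>\<open>Conclusion.\<close> The coefficient \<open>b\<close> is determined by \<open>n\<close>, because \<open>det2 (u 0) (u t)\<close>
  satisfies the same scalar recurrence and has its first positive zero at \<open>t = 2 * n + 1\<close>; a discrete
  Sturm comparison separates the first zeros for different coefficients
  (lemma \<open>sturm_first_zero_unique\<close>). Hence the linear map that matches the first two vectors of two
  configurations matches all of them.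
\<close>

section \<open>The determinant of two plane vectors\<close>

lemma det2_eq: "det2 v w = v $ 1 * w $ 2 - v $ 2 * w $ 1"
  by (simp add: det2_def det_2)

lemma det2_bilinear [simp]:
  "det2 (a + b) c = det2 a c + det2 b c" "det2 c (a + b) = det2 c a + det2 c b"
  "det2 (a - b) c = det2 a c - det2 b c" "det2 c (a - b) = det2 c a - det2 c b"
  "det2 (- a) c = - det2 a c" "det2 c (- a) = - det2 c a"
  "det2 (r *\<^sub>R a) c = r * det2 a c" "det2 c (r *\<^sub>R a) = r * det2 c a"
  "det2 a a = 0" "det2 0 a = 0" "det2 a 0 = 0"
  by (simp_all add: det2_eq algebra_simps)

lemma det2_swap: "det2 w v = - det2 v w"
  by (simp add: det2_eq)

lemma cramer_det2: "det2 u v *\<^sub>R w = det2 w v *\<^sub>R u + det2 u w *\<^sub>R v"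
  by (simp add: vec_eq_iff forall_2 det2_eq algebra_simps)

lemma det2_zero_imp_dependent:
  assumes "det2 v w = 0" "v \<noteq> w"
  shows "dependent {v, w}"
proof (cases "w = 0")
  case True
  then show ?thesis by (simp add: dependent_zero)
next
  case False
  have "(w \<bullet> w) *\<^sub>R v = (v \<bullet> w) *\<^sub>R w"
  proof -
    have "v $ 1 * w $ 2 = v $ 2 * w $ 1" using assms(1) by (simp add: det2_eq)
    then show ?thesis
      by (simp add: vec_eq_iff forall_2 inner_vec_def sum_2 algebra_simps)
  qed
  then have "inverse (w \<bullet> w) *\<^sub>R ((w \<bullet> w) *\<^sub>R v) = inverse (w \<bullet> w) *\<^sub>R ((v \<bullet> w) *\<^sub>R w)"
    by simp
  then have "v = ((v \<bullet> w) / (w \<bullet> w)) *\<^sub>R w"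
    using False by (simp add: divide_inverse mult.commute)
  then have "v \<in> span {w}"
    by (metis span_base span_scale insertI1)
  moreover have "{v, w} - {v} = {w}" using assms(2) by auto
  ultimately show ?thesis
    unfolding dependent_def by (metis insertI1)
qed

lemma uniform_det2_nonzero:
  "uniform V \<Longrightarrow> v \<in> V \<Longrightarrow> w \<in> V \<Longrightarrow> v \<noteq> w \<Longrightarrow> det2 v w \<noteq> 0"
  unfolding uniform_def using det2_zero_imp_dependent by blast

lemma uniform_if_det2_nonzero:
  assumes "\<And>v w. v \<in> V \<Longrightarrow> w \<in> V \<Longrightarrow> v \<noteq> w \<Longrightarrow> det2 v w \<noteq> 0"
  shows "uniform V"
  unfolding uniform_def
proof (intro ballI impI)
  fix v w assume *: "v \<in> V" "w \<in> V" "v \<noteq> w"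
  then have "det2 v w \<noteq> 0" using assms by blast
  moreover from this have "w \<noteq> 0" by auto
  moreover have "v \<notin> span {w}"
    using \<open>det2 v w \<noteq> 0\<close> by (auto simp: span_singleton)
  ultimately show "independent {v, w}"
    using * by (intro independent_insertI independent_empty) auto
qed

section \<open>Odd functions on a balanced configuration\<close>

text \<open>Balancedness at \<open>v\<close> says that the multiset of the numbers \<open>det2 v w\<close> is symmetric about 0.
  Odd powers and the sign function are the two instances that matter: the former carry the
  algebra, the latter counts the vectors on the two sides of a line.\<close>

lemma balanced_sum_odd:
  fixes g :: "real \<Rightarrow> real"
  assumes "balanced V" "finite V" "v \<in> V" and odd: "\<And>x. g (- x) = - g x"
  shows "(\<Sum>w\<in>V. g (det2 v w)) = 0"
proof -
  let ?A = "V - {v}"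
  let ?M = "mset_set ?A"
  have "image_mset (det2 v) ?M = image_mset (\<lambda>w. - det2 v w) ?M"
  proof (rule multiset_eqI)
    fix x
    have cnt: "count (image_mset f ?M) x = card {w \<in> ?A. f w = x}" for f :: "real^2 \<Rightarrow> real"
    proof -
      have "{w. w \<in># ?M \<and> x = f w} = {w \<in> ?A. f w = x}" using assms(2) by auto
      then show ?thesis using assms(2) by (simp add: count_image_mset')
    qed
    have "card {w \<in> ?A. det2 v w = x} = card {w \<in> ?A. - det2 v w = x}"
    proof -
      have "{w \<in> ?A. - det2 v w = x} = {w \<in> ?A. det2 v w = - x}" by auto
      moreover have "card {w \<in> ?A. det2 v w = x} = card {w \<in> ?A. det2 v w = - x}"
        using assms(1,3) unfolding balanced_def by blast
      ultimately show ?thesis by (simp only:)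
    qed
    then show "count (image_mset (det2 v) ?M) x = count (image_mset (\<lambda>w. - det2 v w) ?M) x"
      by (simp only: cnt)
  qed
  then have "image_mset g (image_mset (det2 v) ?M) = image_mset g (image_mset (\<lambda>w. - det2 v w) ?M)"
    by simp
  then have "(\<Sum>w\<in>?A. g (det2 v w)) = (\<Sum>w\<in>?A. g (- det2 v w))"
    by (simp add: sum_unfold_sum_mset multiset.map_comp o_def)
  then have "(\<Sum>w\<in>?A. g (det2 v w)) = 0"
    by (simp add: odd sum_negf)
  moreover have "g (det2 v v) = 0" using odd[of 0] by simp
  ultimately show ?thesis
    using assms(2,3) by (simp add: sum.remove)
qed

section \<open>Newton's identities for odd power sums\<close>

text \<open>The reversed polynomial with roots \<open>t a\<close> is handled as a power series, so that its
  logarithmic derivative makes sense; the coefficient at \<open>card A\<close> is the one that detects a zero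
  among the \<open>t a\<close>. The bound on the degree is there to carry the induction.\<close>

lemma fps_nth_prod_linear:
  fixes t :: "'a \<Rightarrow> 'b::comm_ring_1"
  assumes "finite A"
  shows "fps_nth (\<Prod>a\<in>A. 1 - fps_const (t a) * fps_X) (card A) = (\<Prod>a\<in>A. - t a)
    \<and> (\<forall>k>card A. fps_nth (\<Prod>a\<in>A. 1 - fps_const (t a) * fps_X) k = 0)"
  using assms
proof (induction A)
  case empty
  then show ?case by simp
next
  case (insert x A)
  have *: "fps_nth ((1 - fps_const c * fps_X) * F) (Suc k) = fps_nth F (Suc k) - c * fps_nth F k"
    for F :: "'b fps" and c k
    by (simp add: left_diff_distrib mult.assoc)
  have "fps_nth ((1 - fps_const (t x) * fps_X) * (\<Prod>a\<in>A. 1 - fps_const (t a) * fps_X)) k = 0"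
    if "k > Suc (card A)" for k
    using that insert.IH by (cases k) (simp_all add: *)
  then show ?case
    using insert by (simp add: *)
qed

text \<open>Newton's identities in generating function form: each factor \<open>1 - c X\<close> has logarithmic
  derivative \<open>- c / (1 - c X)\<close>, a geometric series.\<close>

lemma fps_deriv_prod_linear:
  fixes t :: "'a \<Rightarrow> 'b::field"
  assumes "finite A"
  shows "fps_deriv (\<Prod>a\<in>A. 1 - fps_const (t a) * fps_X)
    = - (\<Prod>a\<in>A. 1 - fps_const (t a) * fps_X) * Abs_fps (\<lambda>k. \<Sum>a\<in>A. t a ^ Suc k)"
  using assms
proof (induction A)
  case empty
  then show ?case by (simp add: fps_eq_iff)
next
  case (insert x A)
  let ?L = "1 - fps_const (t x) * fps_X"
  let ?F = "\<Prod>a\<in>A. 1 - fps_const (t a) * fps_X"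
  let ?G = "Abs_fps (\<lambda>k. t x ^ Suc k)"
  let ?P = "Abs_fps (\<lambda>k. \<Sum>a\<in>A. t a ^ Suc k)"
  have geo: "?L * ?G = fps_const (t x)"
  proof (rule fps_ext)
    fix k show "fps_nth (?L * ?G) k = fps_nth (fps_const (t x)) k"
      by (cases k) (simp_all add: left_diff_distrib mult.assoc)
  qed
  have split: "Abs_fps (\<lambda>k. \<Sum>a\<in>insert x A. t a ^ Suc k) = ?G + ?P"
    using insert by (simp add: fps_eq_iff)
  have "fps_deriv (?L * ?F) = - fps_const (t x) * ?F + ?L * (- ?F * ?P)"
    using insert by simp
  also have "\<dots> = - (?L * ?G) * ?F - ?L * ?F * ?P"
    unfolding geo by simp
  also have "\<dots> = - (?L * ?F) * (?G + ?P)" by (simp add: algebra_simps)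
  finally show ?case using insert(1,2) unfolding split by simp
qed

text \<open>If the odd power sums vanish, then so do the odd elementary symmetric functions: in Newton's
  identity for an odd index every term contains either an odd power sum or an odd elementary
  symmetric function of smaller index. As \<open>card A\<close> is odd, the product of all numbers is one of them.\<close>

lemma odd_power_sums_zero_imp_zero:
  fixes t :: "'a \<Rightarrow> 'b::field_char_0"
  assumes fin: "finite A" and odd: "odd (card A)"
    and ps: "\<And>k. odd k \<Longrightarrow> k \<le> card A \<Longrightarrow> (\<Sum>a\<in>A. t a ^ k) = 0"
  shows "\<exists>a\<in>A. t a = 0"
proof -
  define F where "F = (\<Prod>a\<in>A. 1 - fps_const (t a) * fps_X)"
  define P where "P = Abs_fps (\<lambda>k. \<Sum>a\<in>A. t a ^ Suc k)"
  have "fps_nth F k = 0" if "odd k" "k \<le> card A" for k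
    using that
  proof (induction k rule: less_induct)
    case (less k)
    then obtain j where j: "k = Suc j" by (cases k) auto
    have "of_nat k * fps_nth F k = fps_nth (fps_deriv F) j" by (simp add: j)
    also have "\<dots> = - (\<Sum>i=0..j. fps_nth F i * fps_nth P (j - i))"
      unfolding F_def P_def by (simp only: fps_deriv_prod_linear[OF fin] fps_neg_nth fps_mult_nth mult_minus_left)
    also have "(\<Sum>i=0..j. fps_nth F i * fps_nth P (j - i)) = 0"
    proof (rule sum.neutral, rule ballI)
      fix i assume i: "i \<in> {0..j}"
      show "fps_nth F i * fps_nth P (j - i) = 0"
      proof (cases "odd i")
        case True
        then show ?thesis using less i j by auto
      next
        case False
        then have "fps_nth P (j - i) = 0"
          using ps[of "Suc (j - i)"] less.prems i j by (auto simp: P_def)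
        then show ?thesis by simp
      qed
    qed
    finally show ?case using j by (simp del: of_nat_Suc)
  qed
  then have "(\<Prod>a\<in>A. - t a) = 0"
    using fps_nth_prod_linear[OF fin, of t] odd by (auto simp: F_def)
  then show ?thesis using fin by (simp add: prod_zero_iff)
qed

section \<open>Sums of two vectors are parallel to a third one\<close>

locale uniform_balanced =
  fixes V :: "(real ^ 2) set" and n :: nat
  assumes bal: "balanced V" and uni: "uniform V" and fin: "finite V"
    and card: "card V = 2 * n + 1" and n: "n \<ge> 1"
begin

text \<open>Restrict the form \<open>x \<mapsto> (\<Sum>a\<in>V. det2 x a ^ k)\<close> to the affine line through \<open>w\<close> in direction
  \<open>v\<close>. This gives a polynomial of degree at most \<open>k\<close>. The affine line meets the line of every
  member of \<open>V\<close> other than \<open>v\<close>, so the polynomial has \<open>2 * n > k\<close> roots, and it vanishes also at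
  the parameter 1, which is the point \<open>v + w\<close>.\<close>

lemma odd_power_sums_vanish:
  assumes v: "v \<in> V" and w: "w \<in> V" and vw: "v \<noteq> w" and odd: "odd k" and k: "k < 2 * n"
  shows "(\<Sum>a\<in>V. det2 (v + w) a ^ k) = 0"
proof -
  define p where "p = (\<Sum>a\<in>V. [:det2 w a, det2 v a:] ^ k)"
  \<comment> \<open>the parameter at which the affine line meets the line spanned by \<open>a\<close>\<close>
  define s where "s a = - det2 w a / det2 v a" for a
  have poly_p: "poly p x = (\<Sum>a\<in>V. det2 (x *\<^sub>R v + w) a ^ k)" for x
    by (simp add: p_def poly_sum poly_power algebra_simps)
  have nz: "det2 v a \<noteq> 0" if "a \<in> V - {v}" for a
    using uniform_det2_nonzero[OF uni v] that by blast
  have par: "s a *\<^sub>R v + w = (- det2 v w / - det2 v a) *\<^sub>R a" if a: "a \<in> V - {v}" for a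
  proof -
    have "det2 v a *\<^sub>R (s a *\<^sub>R v + w) = det2 v w *\<^sub>R a"
      using nz[OF a] cramer_det2[of v a w] cramer_det2[of v w a] det2_swap[of w a]
      by (simp add: s_def algebra_simps)
    then have "inverse (det2 v a) *\<^sub>R (det2 v a *\<^sub>R (s a *\<^sub>R v + w))
      = inverse (det2 v a) *\<^sub>R (det2 v w *\<^sub>R a)" by simp
    then show ?thesis
      using nz[OF a] by (simp add: field_simps)
  qed
  have root: "poly p (s a) = 0" if a: "a \<in> V - {v}" for a
  proof -
    have "poly p (s a) = (- det2 v w / - det2 v a) ^ k * (\<Sum>b\<in>V. det2 a b ^ k)"
      unfolding poly_p par[OF a] by (simp add: power_mult_distrib power_divide sum_distrib_left)
    also have "(\<Sum>b\<in>V. det2 a b ^ k) = 0"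
      using a by (intro balanced_sum_odd[OF bal fin]) (auto simp: odd)
    finally show ?thesis by simp
  qed
  have inj: "inj_on s (V - {v})"
  proof (rule inj_onI, rule ccontr)
    fix a b assume *: "a \<in> V - {v}" "b \<in> V - {v}" "s a = s b" "a \<noteq> b"
    have "(det2 v w / det2 v a) *\<^sub>R a = (det2 v w / det2 v b) *\<^sub>R b"
      using par[OF *(1)] par[OF *(2)] *(3) by simp
    then have "det2 ((det2 v w / det2 v a) *\<^sub>R a) ((det2 v w / det2 v b) *\<^sub>R b) = 0"
      by (metis det2_bilinear(9))
    moreover have "det2 v w \<noteq> 0" using uniform_det2_nonzero[OF uni v w vw] .
    moreover have "det2 a b \<noteq> 0" using uniform_det2_nonzero[OF uni] * by blast
    ultimately show False using nz *(1,2) by simp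
  qed
  have deg: "degree p \<le> k"
    unfolding p_def
  proof (rule degree_sum_le[OF fin])
    fix a
    have "degree ([:det2 w a, det2 v a:] ^ k) \<le> degree [:det2 w a, det2 v a:] * k"
      by (rule degree_power_le)
    also have "\<dots> \<le> 1 * k" by (intro mult_right_mono) auto
    finally show "degree ([:det2 w a, det2 v a:] ^ k) \<le> k" by simp
  qed
  have "p = 0"
  proof (rule ccontr)
    assume "p \<noteq> 0"
    have "2 * n = card (s ` (V - {v}))"
      using card v fin by (simp add: card_image[OF inj])
    also have "\<dots> \<le> card {x. poly p x = 0}"
      using root by (intro card_mono poly_roots_finite[OF \<open>p \<noteq> 0\<close>]) auto
    also have "\<dots> \<le> degree p" by (rule card_poly_roots_bound[OF \<open>p \<noteq> 0\<close>])
    finally show False using deg k by simp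
  qed
  then show ?thesis using poly_p[of 1] by simp
qed

text \<open>In the power sums at \<open>v + w\<close> the terms for \<open>v\<close> and \<open>w\<close> are opposite to each other. This
  cancellation is decisive: it lowers the number of terms to \<open>2 * n - 1\<close>, which is exactly the
  order up to which the odd power sums are known to vanish.\<close>

lemma sum_parallel_third:
  assumes v: "v \<in> V" and w: "w \<in> V" and vw: "v \<noteq> w"
  shows "\<exists>u\<in>V. det2 u (v + w) = 0"
proof -
  let ?A = "V - {v, w}"
  have cA: "card ?A = 2 * n - 1" using card v w vw fin by (simp add: card_Diff_subset)
  have "\<exists>a\<in>?A. det2 (v + w) a = 0"
  proof (rule odd_power_sums_zero_imp_zero)
    fix k assume k: "odd k" "k \<le> card ?A"
    have "(\<Sum>a\<in>V. det2 (v + w) a ^ k) = 0"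
      using k cA n by (intro odd_power_sums_vanish[OF v w vw]) auto
    moreover have "(\<Sum>a\<in>V. det2 (v + w) a ^ k) = (\<Sum>a\<in>?A. det2 (v + w) a ^ k) + (\<Sum>a\<in>{v,w}. det2 (v + w) a ^ k)"
      using fin v w by (intro sum.subset_diff) auto
    moreover have "(\<Sum>a\<in>{v,w}. det2 (v + w) a ^ k) = 0"
      using vw k(1) det2_swap[of w v] by simp
    ultimately show "(\<Sum>a\<in>?A. det2 (v + w) a ^ k) = 0" by simp
  qed (use fin cA n in auto)
  then show ?thesis by (metis DiffD1 det2_swap minus_zero)
qed

text \<open>Balancedness alone only pairs the vectors off at each \<open>u\<close>, possibly ambiguously. For fixed
  \<open>v\<close> send \<open>x\<close> to the vector \<open>mid x\<close> that is parallel to \<open>v + x\<close>. Each \<open>y\<close> other than \<open>v\<close> is hit,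
  since balancedness at \<open>y\<close> provides an \<open>x\<close> with \<open>det2 y x = - det2 y v\<close>. A surjection of a
  finite set onto itself is injective, and this is the uniqueness of the partner.\<close>

lemma partner_unique:
  assumes V: "u \<in> V" "v \<in> V" "w \<in> V" "w' \<in> V" and neq: "v \<noteq> w" "v \<noteq> w'"
    and par: "det2 u (v + w) = 0" "det2 u (v + w') = 0"
  shows "w = w'"
proof -
  let ?A = "V - {v}"
  define mid where "mid x = (SOME u. u \<in> V \<and> det2 u (v + x) = 0)" for x
  have mid: "mid x \<in> V \<and> det2 (mid x) (v + x) = 0" if "x \<in> ?A" for x
    unfolding mid_def
    by (rule someI_ex) (use sum_parallel_third[OF V(2), of x] that in auto)
  have mid_eq: "mid x = u" if x: "x \<in> ?A" and u: "u \<in> V" "det2 u (v + x) = 0" for x u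
  proof (rule ccontr)
    assume "mid x \<noteq> u"
    then have "det2 (mid x) u \<noteq> 0" using mid[OF x] uniform_det2_nonzero[OF uni _ u(1)] by blast
    moreover have "det2 (mid x) u *\<^sub>R (v + x) = 0"
      using cramer_det2[of "mid x" u "v + x"] mid[OF x] u(2) det2_swap[of u "v + x"] by simp
    ultimately have "v + x = 0" by simp
    then have "x = - v" by (simp add: eq_neg_iff_add_eq_0 add.commute)
    then have "det2 v x = 0" by simp
    then show False using uniform_det2_nonzero[OF uni V(2)] x by blast
  qed
  have "?A \<subseteq> mid ` ?A"
  proof
    fix y assume y: "y \<in> ?A"
    have ne: "det2 y v \<noteq> 0" using uniform_det2_nonzero[OF uni _ V(2)] y by blast
    have "v \<in> {a \<in> V - {y}. det2 y a = det2 y v}" using y V by auto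
    then have "0 < card {a \<in> V - {y}. det2 y a = det2 y v}" using fin by (subst card_gt_0_iff) auto
    moreover have "card {a \<in> V - {y}. det2 y a = det2 y v} = card {a \<in> V - {y}. det2 y a = - det2 y v}"
      using bal y unfolding balanced_def by blast
    ultimately have "{a \<in> V - {y}. det2 y a = - det2 y v} \<noteq> {}"
      by (metis card.empty less_irrefl)
    then obtain x where x: "x \<in> V" "det2 y x = - det2 y v" by blast
    then have "x \<in> ?A" using ne by auto
    moreover have "mid x = y" using mid_eq[OF \<open>x \<in> ?A\<close>, of y] y x by simp
    ultimately show "y \<in> mid ` ?A" by blast
  qed
  then have "inj_on mid ?A" using fin by (intro finite_surj_inj) auto
  moreover have "mid w = u" "mid w' = u" using mid_eq V neq par by auto
  ultimately show ?thesis using V neq by (auto dest: inj_onD)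
qed

end

section \<open>Enumeration by angle\<close>

text \<open>On the open half plane to the left of \<open>e\<close>, the negative cotangent \<open>\<kappa>\<close> of the angle with \<open>e\<close>
  increases with that angle, so sorting by \<open>\<kappa>\<close> sorts by angle.\<close>

lemma half_plane_enumeration:
  assumes fin: "finite W" and pos: "\<And>w. w \<in> W \<Longrightarrow> det2 e w > 0"
    and nz: "\<And>v w. v \<in> W \<Longrightarrow> w \<in> W \<Longrightarrow> v \<noteq> w \<Longrightarrow> det2 v w \<noteq> 0"
  obtains f :: "nat \<Rightarrow> real ^ 2" where "f ` {..<card W} = W"
    and "\<And>i j. i < j \<Longrightarrow> j < card W \<Longrightarrow> det2 (f i) (f j) > 0"
proof (cases "e = 0")
  case True
  then have "W = {}" using pos by force
  then show ?thesis using that[of "\<lambda>_. 0"] by simp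
next
  case False
  define \<kappa> where "\<kappa> w = - (e \<bullet> w) / det2 e w" for w
  have less: "det2 v w > 0" if vw: "v \<in> W" "w \<in> W" "\<kappa> v < \<kappa> w" for v w
  proof -
    have "(e \<bullet> e) * det2 v w = (e \<bullet> v) * det2 e w - (e \<bullet> w) * det2 e v"
      by (simp add: det2_eq inner_vec_def sum_2 algebra_simps)
    also have "\<dots> > 0"
      using vw pos[OF vw(1)] pos[OF vw(2)] by (simp add: \<kappa>_def field_simps)
    finally show ?thesis using False zero_less_mult_pos[of "e \<bullet> e" "det2 v w"] by simp
  qed
  have inj: "inj_on \<kappa> W"
  proof (rule inj_onI, rule ccontr)
    fix v w assume vw: "v \<in> W" "w \<in> W" "\<kappa> v = \<kappa> w" "v \<noteq> w"
    have "(e \<bullet> e) * det2 v w = (e \<bullet> v) * det2 e w - (e \<bullet> w) * det2 e v"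
      by (simp add: det2_eq inner_vec_def sum_2 algebra_simps)
    also have "\<dots> = 0"
      using vw(3) pos[OF vw(1)] pos[OF vw(2)] by (simp add: \<kappa>_def field_simps)
    finally show False using False nz[OF vw(1,2,4)] by simp
  qed
  define xs where "xs = sorted_list_of_set (\<kappa> ` W)"
  have xs: "set xs = \<kappa> ` W" "length xs = card W" "sorted_wrt (<) xs"
    using fin by (auto simp: xs_def card_image[OF inj])
  define f where "f i = inv_into W \<kappa> (xs ! i)" for i
  have fW: "f i \<in> W" "\<kappa> (f i) = xs ! i" if "i < card W" for i
    using that xs(1,2) nth_mem[of i xs] by (auto simp: f_def inv_into_into f_inv_into_f)
  have "f ` {..<card W} = W"
  proof
    show "f ` {..<card W} \<subseteq> W" using fW by auto
    show "W \<subseteq> f ` {..<card W}"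
    proof
      fix w assume w: "w \<in> W"
      then obtain i where "i < card W" "xs ! i = \<kappa> w"
        using xs(1,2) by (metis imageI in_set_conv_nth)
      then show "w \<in> f ` {..<card W}"
        using w inj by (intro image_eqI[of _ _ i]) (auto simp: f_def)
    qed
  qed
  moreover have "det2 (f i) (f j) > 0" if "i < j" "j < card W" for i j
    using that fW[of i] fW[of j] xs(2,3) by (intro less) (auto simp: sorted_wrt_nth_less)
  ultimately show ?thesis using that by blast
qed

text \<open>The lines of \<open>V\<close> are enumerated by angle, starting from \<open>v\<^sub>0\<close>, and each other line is represented by the
  member of \<open>V\<close> or its opposite that lies to the left of \<open>v\<^sub>0\<close>. After a half turn the same lines
  recur with opposite representatives; continuing in this way makes the enumeration homogeneous,
  so that later arguments need not treat any index as the first one.\<close>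

lemma angular_enumeration:
  assumes fin: "finite V" and uni: "uniform V" and v0: "v\<^sub>0 \<in> V"
  obtains u :: "nat \<Rightarrow> real ^ 2" where "u 0 = v\<^sub>0" "\<And>t. u (t + card V) = - u t"
    "\<And>i j. i < j \<Longrightarrow> j < i + card V \<Longrightarrow> det2 (u i) (u j) > 0"
    "\<And>t. u t \<in> V \<or> - u t \<in> V"
proof -
  let ?m = "card V"
  define h where "h w = (if det2 v\<^sub>0 w > 0 then w else - w)" for w
  define W where "W = h ` (V - {v\<^sub>0})"
  have nz: "det2 v w \<noteq> 0" if "v \<in> V" "w \<in> V" "v \<noteq> w" for v w
    using uniform_det2_nonzero[OF uni] that .
  have hnz: "det2 (h v) (h w) \<noteq> 0" if "v \<in> V" "w \<in> V" "v \<noteq> w" for v w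
    using nz[OF that] by (auto simp: h_def)
  have inj: "inj_on h (V - {v\<^sub>0})"
  proof (rule inj_onI, rule ccontr)
    fix v w assume "v \<in> V - {v\<^sub>0}" "w \<in> V - {v\<^sub>0}" "h v = h w" "v \<noteq> w"
    then show False using hnz[of v w] by simp
  qed
  have m: "?m > 0" using v0 fin by (auto simp: card_gt_0_iff)
  have cW: "card W = ?m - 1" using v0 fin by (simp add: W_def card_image[OF inj])
  have Wpos: "det2 v\<^sub>0 w > 0" if "w \<in> W" for w
    using that nz[OF v0] by (auto simp: W_def h_def not_less less_le)
  obtain f where f: "f ` {..<?m - 1} = W" "\<And>i j. i < j \<Longrightarrow> j < ?m - 1 \<Longrightarrow> det2 (f i) (f j) > 0"
  proof (rule half_plane_enumeration[of W "v\<^sub>0"])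
    show "finite W" using fin by (simp add: W_def)
    show "det2 v w \<noteq> 0" if "v \<in> W" "w \<in> W" "v \<noteq> w" for v w
      using that hnz by (auto simp: W_def)
  qed (use Wpos cW in auto)
  define g where "g i = (if i = 0 then v\<^sub>0 else f (i - 1))" for i
  define u where "u t = (- 1) ^ (t div ?m) *\<^sub>R g (t mod ?m)" for t
  have gpos: "det2 (g i) (g j) > 0" if "i < j" "j < ?m" for i j
  proof (cases "i = 0")
    case True
    have "f (j - 1) \<in> W" using f(1) that by auto
    then show ?thesis using True that Wpos by (simp add: g_def)
  next
    case False
    then show ?thesis using that f(2)[of "i - 1" "j - 1"] by (simp add: g_def)
  qed
  have gV: "g i \<in> V \<or> - g i \<in> V" if "i < ?m" for i
  proof (cases "i = 0")
    case False
    then have "f (i - 1) \<in> W" using f(1) that by auto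
    then show ?thesis using False by (auto simp: g_def W_def h_def)
  qed (simp add: g_def v0)
  have "u 0 = v\<^sub>0" by (simp add: u_def g_def)
  moreover have period: "u (t + ?m) = - u t" for t
    using m by (simp add: u_def)
  moreover have "det2 (u i) (u j) > 0" if "i < j" "j < i + ?m" for i j
    using that
  proof (induction i arbitrary: j rule: less_induct)
    case (less i)
    have shift: "u k = - u (k - ?m)" if "k \<ge> ?m" for k
      using period[of "k - ?m"] that by simp
    have small: "u k = g k" if "k < ?m" for k
      using that by (simp add: u_def)
    consider "j < ?m" | "i < ?m" "j \<ge> ?m" | "i \<ge> ?m" using less.prems by linarith
    then show ?case
    proof cases
      case 1
      then show ?thesis using gpos less.prems by (simp add: small)
    next
      case 2
      then have "j - ?m < i" using less.prems by linarith
      then have "det2 (g (j - ?m)) (g i) > 0" using gpos 2 by simp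
      moreover have "u j = - g (j - ?m)" "u i = g i"
        using shift[of j] small[of "j - ?m"] small[of i] 2 \<open>j - ?m < i\<close> by auto
      ultimately show ?thesis using det2_swap[of "g i" "g (j - ?m)"] by simp
    next
      case 3
      have "det2 (u (i - ?m)) (u (j - ?m)) > 0"
        by (rule less.IH) (use 3 less.prems m in auto)
      then show ?thesis using shift[of i] shift[of j] 3 less.prems by simp
    qed
  qed
  moreover have "u t \<in> V \<or> - u t \<in> V" for t
    using gV[of "t mod ?m"] m by (cases "even (t div ?m)") (auto simp: u_def)
  ultimately show ?thesis using that by blast
qed

context uniform_balanced
begin

text \<open>Let \<open>\<epsilon> t\<close> be the sign with which \<open>u t\<close> belongs to \<open>V\<close>. Balancedness at the member \<open>\<epsilon> t *\<^sub>R u t\<close>,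
  tested with the sign function, says that the signs at the \<open>2 * n\<close> indices after \<open>t\<close> add up to 0.
  Subtracting this statement for \<open>t\<close> from that for \<open>Suc t\<close> gives
  \<open>\<epsilon> (Suc t) = \<epsilon> (t + (2 * n + 1)) = - \<epsilon> t\<close>.\<close>

lemma alternating_enumeration:
  obtains u :: "nat \<Rightarrow> real ^ 2" where "\<And>t. u (t + (2 * n + 1)) = - u t"
    "\<And>i j. i < j \<Longrightarrow> j < i + (2 * n + 1) \<Longrightarrow> det2 (u i) (u j) > 0"
    "\<And>t. bij_betw (\<lambda>j. (- 1) ^ j *\<^sub>R u j) {t..<t + (2 * n + 1)} V"
proof -
  let ?m = "2 * n + 1"
  obtain v\<^sub>0 where v0: "v\<^sub>0 \<in> V" using card by fastforce
  obtain u where u: "u 0 = v\<^sub>0" "\<And>t. u (t + ?m) = - u t"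
    "\<And>i j. i < j \<Longrightarrow> j < i + ?m \<Longrightarrow> det2 (u i) (u j) > 0" "\<And>t. u t \<in> V \<or> - u t \<in> V"
    by (rule angular_enumeration[OF fin uni v0, unfolded card]) blast
  define \<epsilon> :: "nat \<Rightarrow> real" where "\<epsilon> t = (if u t \<in> V then 1 else - 1)" for t
  define w where "w t = \<epsilon> t *\<^sub>R u t" for t
  have \<epsilon>: "\<epsilon> t = 1 \<or> \<epsilon> t = - 1" for t by (simp add: \<epsilon>_def)
  have wV: "w t \<in> V" for t using u(4)[of t] by (auto simp: w_def \<epsilon>_def)
  have not_both: "\<not> (u t \<in> V \<and> - u t \<in> V)" for t
  proof
    assume *: "u t \<in> V \<and> - u t \<in> V"
    have "det2 (u t) (u (Suc t)) > 0" using u(3)[of t "Suc t"] n by simp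
    then have "det2 (u t) (u (Suc t)) \<noteq> det2 (- u t) (u (Suc t))" by simp
    then have "u t \<noteq> - u t" by metis
    then show False using uniform_det2_nonzero[OF uni, of "u t" "- u t"] * by simp
  qed
  have \<epsilon>_period: "\<epsilon> (t + ?m) = - \<epsilon> t" for t
    using not_both[of t] u(4)[of t] unfolding \<epsilon>_def u(2) by auto
  have bij: "bij_betw w {t..<t + ?m} V" for t
  proof -
    have ne: "w i \<noteq> w j" if "i < j" "j < i + ?m" for i j
    proof
      assume "w i = w j"
      then have "det2 (w i) (w j) = 0" by simp
      then show False using u(3)[OF that] \<epsilon>[of i] \<epsilon>[of j] by (auto simp: w_def)
    qed
    have inj: "inj_on w {t..<t + ?m}"
    proof (rule inj_onI, rule ccontr)
      fix i j assume "i \<in> {t..<t + ?m}" "j \<in> {t..<t + ?m}" "w i = w j" "i \<noteq> j"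
      then show False using ne[of i j] ne[of j i] by (cases "i < j") auto
    qed
    have "card (w ` {t..<t + ?m}) = card V"
      unfolding card_image[OF inj] by (simp add: card)
    then have "w ` {t..<t + ?m} = V"
      using wV by (intro card_subset_eq[OF fin]) auto
    then show ?thesis using inj by (simp add: bij_betw_def)
  qed
  have sum0: "(\<Sum>j\<in>{Suc t..<t + ?m}. \<epsilon> j) = 0" for t
  proof -
    have "0 = (\<Sum>x\<in>V. sgn (det2 (w t) x))"
      using balanced_sum_odd[OF bal fin wV, of sgn t] by (simp add: sgn_minus)
    also have "\<dots> = (\<Sum>j\<in>{t..<t + ?m}. sgn (det2 (w t) (w j)))"
      by (rule sum.reindex_bij_betw[OF bij, symmetric])
    also have "\<dots> = sgn (det2 (w t) (w t)) + (\<Sum>j\<in>{Suc t..<t + ?m}. sgn (det2 (w t) (w j)))"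
      by (rule sum.atLeast_Suc_lessThan) simp
    also have "\<dots> = (\<Sum>j\<in>{Suc t..<t + ?m}. \<epsilon> t * \<epsilon> j)"
    proof -
      have "sgn (det2 (w t) (w j)) = \<epsilon> t * \<epsilon> j" if "j \<in> {Suc t..<t + ?m}" for j
      proof -
        have "det2 (u t) (u j) > 0" using u(3)[of t j] that by simp
        then show ?thesis using \<epsilon>[of t] \<epsilon>[of j] by (auto simp: w_def sgn_mult)
      qed
      then show ?thesis by simp
    qed
    finally show ?thesis using \<epsilon>[of t] by (auto simp: sum_distrib_left[symmetric])
  qed
  have alt: "\<epsilon> (Suc t) = - \<epsilon> t" for t
  proof -
    have "(\<Sum>j\<in>{Suc t..<t + ?m}. \<epsilon> j) = \<epsilon> (Suc t) + (\<Sum>j\<in>{Suc (Suc t)..<t + ?m}. \<epsilon> j)"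
      using n by (intro sum.atLeast_Suc_lessThan) simp
    moreover have "(\<Sum>j\<in>{Suc (Suc t)..<Suc (t + ?m)}. \<epsilon> j)
      = (\<Sum>j\<in>{Suc (Suc t)..<t + ?m}. \<epsilon> j) + \<epsilon> (t + ?m)"
      using n by (intro sum.atLeastLessThan_Suc) simp
    ultimately show ?thesis using sum0[of t] sum0[of "Suc t"] \<epsilon>_period[of t] by simp
  qed
  have "\<epsilon> t = (- 1) ^ t" for t
    by (induction t) (auto simp: alt, simp add: \<epsilon>_def u(1) v0)
  then have "w = (\<lambda>j. (- 1) ^ j *\<^sub>R u j)" by (auto simp: w_def)
  then show ?thesis using that u(2,3) bij by blast
qed

section \<open>The recurrence and its coefficient\<close>

text \<open>That \<open>u t + u (t + 2)\<close> is parallel to \<open>u (t + 1)\<close> means that the area \<open>d t\<close> spanned by two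
  consecutive vectors is constant. The coefficient \<open>b t\<close> is the area spanned by \<open>u t\<close> and
  \<open>u (t + 2)\<close> in units of \<open>d t\<close>, and that \<open>u t + u (t + 4)\<close> is parallel to \<open>u (t + 2)\<close> means that
  this area is the same at \<open>t\<close> and at \<open>t + 2\<close>.\<close>

lemma three_term_recurrence:
  obtains u :: "nat \<Rightarrow> real ^ 2" and b :: real where "\<And>t. u (Suc (Suc t)) = b *\<^sub>R u (Suc t) - u t"
    "u (2 * n + 1) = - u 0"
    "\<And>t. 0 < t \<Longrightarrow> t < 2 * n + 1 \<Longrightarrow> det2 (u 0) (u t) > 0"
    "V = (\<lambda>j. (- 1) ^ j *\<^sub>R u j) ` {..<2 * n + 1}"
proof -
  let ?m = "2 * n + 1"
  obtain u where u: "\<And>t. u (t + ?m) = - u t"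
    "\<And>i j. i < j \<Longrightarrow> j < i + ?m \<Longrightarrow> det2 (u i) (u j) > 0"
    "\<And>t. bij_betw (\<lambda>j. (- 1) ^ j *\<^sub>R u j) {t..<t + ?m} V"
    by (rule alternating_enumeration) blast
  define w where "w j = (- 1) ^ j *\<^sub>R u j" for j
  have bij: "bij_betw w {t..<t + ?m} V" for t
    using u(3)[of t] by (simp add: w_def[abs_def])
  have wV: "w t \<in> V" for t
    using bij_betwE[OF bij[of t]] by simp
  have w_ne: "w i \<noteq> w j" if "i < j" "j < i + ?m" for i j
    using bij_betw_imp_inj_on[OF bij[of i]] that by (auto dest: inj_onD)
  have par: "det2 (w k) (w i + w j) = 0 \<longleftrightarrow> det2 (u k) (u i + u j) = 0" if "even (i + j)" for i j k
  proof -
    have "(- 1) ^ j = (- 1 :: real) ^ i"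
      using that by (auto simp: minus_one_power_iff)
    then have "det2 (w k) (w i + w j) = ((- 1) ^ k * (- 1) ^ i) * det2 (u k) (u i + u j)"
      by (simp add: w_def algebra_simps)
    then show ?thesis by simp
  qed
  \<comment> \<open>for indices of equal parity the signs agree, so \<open>w i + w j\<close> lies, up to sign, in the open cone
    between \<open>u i\<close> and \<open>u j\<close>, and only lines strictly between them can contain it\<close>
  have third: "\<exists>k. i < k \<and> k < j \<and> det2 (u k) (u i + u j) = 0"
    if ij: "i < j" "j < i + ?m" "even (i + j)" for i j
  proof -
    obtain v where v: "v \<in> V" "det2 v (w i + w j) = 0"
      using sum_parallel_third[OF wV wV w_ne[OF ij(1,2)]] by blast
    then have "v \<in> w ` {i..<i + ?m}" using bij[of i] by (simp add: bij_betw_def)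
    then obtain k where k: "i \<le> k" "k < i + ?m" "v = w k" by auto
    have z: "det2 (u k) (u i + u j) = 0" using v k par[OF ij(3)] by simp
    have "k \<noteq> i" using z u(2)[OF ij(1,2)] by auto
    then have ik: "det2 (u i) (u k) > 0" using u(2)[of i k] k by simp
    have "\<not> j \<le> k"
    proof
      assume "j \<le> k"
      then have "det2 (u j) (u k) \<ge> 0" using u(2)[of j k] k ij by (cases "j = k") auto
      then show False using z ik det2_swap[of "u k" "u i"] det2_swap[of "u k" "u j"] by simp
    qed
    then have "k < j" by simp
    moreover have "i < k" using k(1) \<open>k \<noteq> i\<close> by simp
    ultimately show ?thesis using z by blast
  qed
  have near: "det2 (u (t + 1)) (u t + u (t + 2)) = 0" for t
  proof -
    obtain k where "t < k" "k < t + 2" "det2 (u k) (u t + u (t + 2)) = 0"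
      using third[of t "t + 2"] n by auto
    moreover from this have "k = t + 1" by simp
    ultimately show ?thesis by simp
  qed
  \<comment> \<open>for \<open>n = 1\<close> the index \<open>t + 4\<close> lies beyond a half turn, and three vectors suffice to see it
    directly; otherwise the two outer candidates already pair one summand with \<open>w (t + 2)\<close>\<close>
  have far: "det2 (u (t + 2)) (u t + u (t + 4)) = 0" for t
  proof (cases "n = 1")
    case True
    have "u (t + 3) = - u t" "u (t + 4) = - u (t + 1)"
      using u(1)[of t] u(1)[of "t + 1"] True by (simp_all add: numeral_eq_Suc)
    then show ?thesis
      using near[of "t + 1"] near[of t] det2_swap[of "u (t + 2)" "u (t + 1)"] det2_swap[of "u (t + 1)" "u t"]
       by (simp add: numeral_eq_Suc)
  next
    case False
    obtain k where k: "t < k" "k < t + 4" "det2 (u k) (u t + u (t + 4)) = 0"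
      using third[of t "t + 4"] n False by auto
    have "k \<noteq> t + 1"
    proof
      assume "k = t + 1"
      have "det2 (w (t + 1)) (w t + w (t + 4)) = 0"
        by (rule iffD2[OF par]) (use k \<open>k = t + 1\<close> in auto)
      moreover have "det2 (w (t + 1)) (w t + w (t + 2)) = 0"
        by (rule iffD2[OF par]) (use near[of t] in auto)
      ultimately have "w (t + 4) = w (t + 2)"
        using w_ne[of t "t + 4"] w_ne[of t "t + 2"] n False
        by (intro partner_unique[of "w (t + 1)" "w t"]) (auto simp: wV)
      then show False using w_ne[of "t + 2" "t + 4"] n by simp
    qed
    moreover have "k \<noteq> t + 3"
    proof
      assume "k = t + 3"
      have "det2 (w (t + 3)) (w t + w (t + 4)) = 0"
        by (rule iffD2[OF par]) (use k \<open>k = t + 3\<close> in auto)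
      moreover have "det2 (u (t + 3)) (u (t + 2) + u (t + 4)) = 0"
        using near[of "t + 2"] by (simp add: numeral_eq_Suc)
      then have "det2 (w (t + 3)) (w (t + 2) + w (t + 4)) = 0"
        by (rule iffD2[OF par, rotated]) simp
      ultimately have "w t = w (t + 2)"
        using w_ne[of t "t + 4"] w_ne[of "t + 2" "t + 4"] n False
        by (intro partner_unique[of "w (t + 3)" "w (t + 4)"]) (auto simp: wV)
      then show False using w_ne[of t "t + 2"] n by simp
    qed
    ultimately have "k = t + 2" using k by simp
    then show ?thesis using k by simp
  qed
  define d where "d t = det2 (u t) (u (t + 1))" for t
  define b where "b t = det2 (u t) (u (t + 2)) / d t" for t
  have d_step: "d (Suc t) = d t" for t
    using near[of t] det2_swap[of "u (t + 1)" "u t"] by (simp add: d_def)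
  have d_const: "d t = d 0" for t by (induction t) (simp_all add: d_step)
  have d_pos: "d t > 0" for t using u(2)[of t "t + 1"] n by (simp add: d_def)
  have rec: "u (t + 2) = b t *\<^sub>R u (t + 1) - u t" for t
  proof -
    have "d t *\<^sub>R u (t + 2) = det2 (u (t + 2)) (u (t + 1)) *\<^sub>R u t + det2 (u t) (u (t + 2)) *\<^sub>R u (t + 1)"
      unfolding d_def by (rule cramer_det2)
    also have "det2 (u (t + 2)) (u (t + 1)) = - d t"
      using d_step[of t] det2_swap[of "u (t + 2)" "u (t + 1)"] by (simp add: d_def)
    also have "det2 (u t) (u (t + 2)) = d t * b t" using d_pos[of t] by (simp add: b_def)
    finally have "d t *\<^sub>R u (t + 2) = d t *\<^sub>R (b t *\<^sub>R u (t + 1) - u t)"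
      by (simp add: algebra_simps)
    then show ?thesis using d_pos[of t] by simp
  qed
  have b_step2: "b (t + 2) = b t" for t
    using far[of t] det2_swap[of "u (t + 2)" "u t"] d_const[of t] d_const[of "t + 2"]
    by (simp add: b_def numeral_eq_Suc)
  have b_even: "b (t + 2 * k) = b t" for t k
    using b_step2[of "t + 2 * k" for k] by (induction k) (simp_all add: numeral_eq_Suc)
  have b_period: "b (t + ?m) = b t" for t
    using u(1)[of t] u(1)[of "t + 2"] d_const[of t] d_const[of "t + ?m"] by (simp add: b_def algebra_simps)
  \<comment> \<open>\<open>Suc t + (2 * n + 1)\<close> exceeds \<open>t\<close> by an even number\<close>
  have b_step: "b (Suc t) = b t" for t
    using b_period[of "Suc t"] b_even[of t "n + 1"] by simp
  have b_const: "b t = b 0" for t by (induction t) (simp_all add: b_step)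
  show ?thesis
  proof (rule that)
    show "u (Suc (Suc t)) = b 0 *\<^sub>R u (Suc t) - u t" for t
      using rec[of t] b_const[of t] by (simp add: numeral_eq_Suc)
    show "u ?m = - u 0" using u(1)[of 0] by simp
    show "det2 (u 0) (u t) > 0" if "0 < t" "t < ?m" for t using u(2)[of 0 t] that by simp
    show "V = (\<lambda>j. (- 1) ^ j *\<^sub>R u j) ` {..<?m}"
      using bij[of 0] by (simp add: bij_betw_def w_def[abs_def] atLeast0LessThan)
  qed
qed

end

text \<open>The discrete Wronskian of the two sequences grows by \<open>(b - c) * x j * y j\<close> in step \<open>j\<close>, and it
  vanishes both at the start and at the common zero \<open>m\<close>; in between all products are positive.\<close>

lemma sturm_first_zero_unique:
  fixes x y :: "nat \<Rightarrow> real"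
  assumes x: "\<And>t. x (Suc (Suc t)) = b * x (Suc t) - x t" and y: "\<And>t. y (Suc (Suc t)) = c * y (Suc t) - y t"
    and zero: "x 0 = 0" "y 0 = 0" "x m = 0" "y m = 0"
    and pos: "\<And>t. 0 < t \<Longrightarrow> t < m \<Longrightarrow> x t > 0" "\<And>t. 0 < t \<Longrightarrow> t < m \<Longrightarrow> y t > 0"
    and m: "m \<ge> 2"
  shows "b = c"
proof -
  have W: "x (Suc k) * y k - x k * y (Suc k) = (b - c) * (\<Sum>j\<in>{1..k}. x j * y j)" for k
  proof (induction k)
    case 0
    then show ?case by (simp add: zero)
  next
    case (Suc k)
    then show ?case by (simp add: x y algebra_simps)
  qed
  have "x (Suc (m - 1)) = 0" "y (Suc (m - 1)) = 0" using zero m by simp_all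
  then have "(b - c) * (\<Sum>j\<in>{1..m - 1}. x j * y j) = 0"
    using W[of "m - 1"] by (simp del: One_nat_def)
  moreover have "(\<Sum>j\<in>{1..m - 1}. x j * y j) > 0"
    using m by (intro sum_pos) (auto intro!: mult_pos_pos pos)
  ultimately show ?thesis by simp
qed

section \<open>Any two configurations are equivalent\<close>

lemma det2_matrix_vector_mult: "det2 (A *v v) (A *v w) = det A * det2 v w"
  by (simp add: det2_eq det_2 matrix_vector_mult_def sum_2 algebra_simps)

lemma exists_invertible_matrix_mapping:
  assumes "det2 a b \<noteq> 0" "det2 a' b' \<noteq> 0"
  obtains A :: "real ^ 2 ^ 2" where "invertible A" "A *v a = a'" "A *v b = b'"
proof -
  define f where "f x = (det2 x b / det2 a b) *\<^sub>R a' + (det2 a x / det2 a b) *\<^sub>R b'" for x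
  have lin: "linear f"
    by (rule linearI) (simp_all add: f_def add_divide_distrib algebra_simps)
  have ab: "matrix f *v a = a'" "matrix f *v b = b'"
    using assms by (simp_all add: fun_cong[OF matrix_vector_mul(2)[OF lin]] f_def)
  then have "det (matrix f) * det2 a b = det2 a' b'"
    using det2_matrix_vector_mult[of "matrix f" a b] by simp
  then have "det (matrix f) \<noteq> 0" using assms by auto
  then show ?thesis using that ab invertible_det_nz by blast
qed

lemma uniform_balanced_configurations_iff:
  "V \<in> uniform_balanced_configurations (2 * n + 1) \<and> n \<ge> 1 \<longleftrightarrow> uniform_balanced V n"
  by (auto simp: uniform_balanced_configurations_def uniform_balanced_def configuration_def)

text \<open>The coefficients of the two recurrences agree by the Sturm comparison of
  \<open>det2 (u 0) (u t)\<close> with \<open>det2 (u' 0) (u' t)\<close>; then a linear map that matches the initial values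
  commutes with the recurrence.\<close>

lemma uniform_balanced_equivalent:
  assumes "uniform_balanced V n" "uniform_balanced V' n"
  obtains A :: "real ^ 2 ^ 2" where "invertible A" "(\<lambda>v. A *v v) ` V = V'"
proof -
  let ?m = "2 * n + 1"
  have n: "n \<ge> 1" using assms(1) by (simp add: uniform_balanced_def)
  obtain u b where u: "\<And>t. u (Suc (Suc t)) = b *\<^sub>R u (Suc t) - u t" "u ?m = - u 0"
    "\<And>t. 0 < t \<Longrightarrow> t < ?m \<Longrightarrow> det2 (u 0) (u t) > 0" "V = (\<lambda>j. (- 1) ^ j *\<^sub>R u j) ` {..<?m}"
    by (rule uniform_balanced.three_term_recurrence[OF assms(1)]) blast
  obtain u' b' where u': "\<And>t. u' (Suc (Suc t)) = b' *\<^sub>R u' (Suc t) - u' t" "u' ?m = - u' 0"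
    "\<And>t. 0 < t \<Longrightarrow> t < ?m \<Longrightarrow> det2 (u' 0) (u' t) > 0" "V' = (\<lambda>j. (- 1) ^ j *\<^sub>R u' j) ` {..<?m}"
    by (rule uniform_balanced.three_term_recurrence[OF assms(2)]) blast
  have "b = b'"
  proof (rule sturm_first_zero_unique)
    show "det2 (u 0) (u (Suc (Suc t))) = b * det2 (u 0) (u (Suc t)) - det2 (u 0) (u t)" for t
      by (simp add: u(1))
    show "det2 (u' 0) (u' (Suc (Suc t))) = b' * det2 (u' 0) (u' (Suc t)) - det2 (u' 0) (u' t)" for t
      by (simp add: u'(1))
    show "det2 (u 0) (u ?m) = 0" "det2 (u' 0) (u' ?m) = 0" unfolding u(2) u'(2) by simp_all
  qed (use n u(3) u'(3) in auto)
  have "det2 (u 0) (u 1) \<noteq> 0" "det2 (u' 0) (u' 1) \<noteq> 0" using u(3)[of 1] u'(3)[of 1] n by auto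
  then obtain A where A: "invertible A" "A *v u 0 = u' 0" "A *v u 1 = u' 1"
    by (rule exists_invertible_matrix_mapping)
  have "A *v u t = u' t \<and> A *v u (Suc t) = u' (Suc t)" for t
    by (induction t) (use A in \<open>auto simp: u(1) u'(1) \<open>b = b'\<close> matrix_vector_mult_diff_distrib matrix_vector_mult_scaleR\<close>)
  then have "(\<lambda>v. A *v v) ` V = V'"
    by (simp add: u(4) u'(4) image_image matrix_vector_mult_scaleR)
  then show ?thesis by (rule that[OF A(1)])
qed

section \<open>The group action\<close>

lemma image_uniform_balanced_configuration:
  assumes A: "invertible A" and V: "V \<in> uniform_balanced_configurations m"
  shows "(\<lambda>v. A *v v) ` V \<in> uniform_balanced_configurations m"
proof -
  have inj: "inj ((*v) A)" using A matrix_left_invertible_injective unfolding invertible_def by blast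
  have d: "det A \<noteq> 0" using A invertible_det_nz by blast
  have "uniform ((\<lambda>v. A *v v) ` V)"
  proof (rule uniform_if_det2_nonzero)
    fix v' w' assume "v' \<in> (\<lambda>v. A *v v) ` V" "w' \<in> (\<lambda>v. A *v v) ` V" "v' \<noteq> w'"
    then obtain v w where vw: "v \<in> V" "w \<in> V" "v' = A *v v" "w' = A *v w" "v \<noteq> w" by blast
    then have "det2 v w \<noteq> 0"
      using V uniform_det2_nonzero[of V v w] by (simp add: uniform_balanced_configurations_def)
    then show "det2 v' w' \<noteq> 0" using d by (simp add: vw det2_matrix_vector_mult)
  qed
  moreover have "balanced ((\<lambda>v. A *v v) ` V)"
    unfolding balanced_def
  proof (intro ballI allI)
    fix v' x assume "v' \<in> (\<lambda>v. A *v v) ` V"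
    then obtain v where v: "v \<in> V" "v' = A *v v" by blast
    have "{w \<in> (\<lambda>v. A *v v) ` V - {v'}. det2 v' w = y} = (\<lambda>v. A *v v) ` {w \<in> V - {v}. det2 v w = y / det A}" for y
    proof -
      have "z = y / det A \<longleftrightarrow> det A * z = y" for z using d by (auto simp: field_simps)
      then show ?thesis by (auto simp: v(2) det2_matrix_vector_mult inj_eq[OF inj])
    qed
    then have c: "card {w \<in> (\<lambda>v. A *v v) ` V - {v'}. det2 v' w = y} = card {w \<in> V - {v}. det2 v w = y / det A}" for y
      by (simp add: card_image inj_on_subset[OF inj])
    have "card {w \<in> V - {v}. det2 v w = x / det A} = card {w \<in> V - {v}. det2 v w = - (x / det A)}"
      using V v unfolding uniform_balanced_configurations_def balanced_def by blast
    then show "card {w \<in> (\<lambda>v. A *v v) ` V - {v'}. det2 v' w = x} = card {w \<in> (\<lambda>v. A *v v) ` V - {v'}. det2 v' w = - x}"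
      unfolding c by simp
  qed
  ultimately show ?thesis
    using V by (auto simp: uniform_balanced_configurations_def configuration_def card_image inj_on_subset[OF inj])
qed

lemma group_GL2: "group GL2"
proof (rule groupI)
  fix A assume "A \<in> carrier GL2"
  then obtain B where "A ** B = mat 1" "B ** A = mat 1" by (auto simp: GL2_def invertible_def)
  then show "\<exists>B\<in>carrier GL2. B \<otimes>\<^bsub>GL2\<^esub> A = \<one>\<^bsub>GL2\<^esub>"
    by (auto simp: GL2_def invertible_def)
qed (auto simp: GL2_def invertible_mult matrix_mul_assoc, simp add: invertible_def)

text \<open>As \<open>E\<close> is closed under invertible matrices, the inverse matrix provides an inverse of the
  restricted map, and composites of restricted maps are restrictions of composites.\<close>

lemma group_action_GL2:
  assumes closed: "\<And>A V. invertible A \<Longrightarrow> V \<in> E \<Longrightarrow> (\<lambda>v. A *v v) ` V \<in> E"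
  shows "group_action GL2 E (GL2_action E)"
proof -
  have inE: "GL2_action E A \<in> Bij E" if A: "A \<in> carrier GL2" for A
  proof -
    obtain B where B: "A ** B = mat 1" "B ** A = mat 1"
      using A by (auto simp: GL2_def invertible_def)
    have inv: "invertible A" "invertible B" using B by (auto simp: invertible_def)
    have "bij_betw (GL2_action E A) E E"
      by (rule bij_betw_byWitness[where f' = "GL2_action E B"])
         (use B inv closed in \<open>auto simp: GL2_action_def image_image matrix_vector_mul_assoc\<close>)
    then show ?thesis by (simp add: Bij_def GL2_action_def)
  qed
  have "GL2_action E \<in> hom GL2 (BijGroup E)"
  proof (rule homI)
    fix A B assume AB: "A \<in> carrier GL2" "B \<in> carrier GL2"
    have "GL2_action E (A ** B) = compose E (GL2_action E A) (GL2_action E B)"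
      using AB closed by (auto simp: GL2_action_def GL2_def compose_def fun_eq_iff image_image matrix_vector_mul_assoc)
    then show "GL2_action E (A \<otimes>\<^bsub>GL2\<^esub> B) = GL2_action E A \<otimes>\<^bsub>BijGroup E\<^esub> GL2_action E B"
      using AB inE by (simp add: BijGroup_def GL2_def)
  qed (use inE in \<open>simp add: BijGroup_def\<close>)
  then show ?thesis
    by (simp add: group_action_def group_hom_def group_hom_axioms_def group_GL2 group_BijGroup)
qed

theorem theorem1:
  fixes n m :: nat
  assumes "n \<ge> 1" and "m = 2 * n + 1"
  shows "transitive_action GL2 (uniform_balanced_configurations m)
           (GL2_action (uniform_balanced_configurations m))"
proof -
  let ?E = "uniform_balanced_configurations m"
  interpret group_action GL2 ?E "GL2_action ?E"
    by (intro group_action_GL2 image_uniform_balanced_configuration)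
  show ?thesis
  proof
    fix V V' assume V: "V \<in> ?E" "V' \<in> ?E"
    then have "uniform_balanced V n" "uniform_balanced V' n"
      using assms uniform_balanced_configurations_iff by blast+
    then obtain A :: "real ^ 2 ^ 2" where "invertible A" "(\<lambda>v. A *v v) ` V = V'"
      by (rule uniform_balanced_equivalent)
    then show "\<exists>A\<in>carrier GL2. GL2_action ?E A V = V'"
      using V by (auto simp: GL2_def GL2_action_def)
  qed
qed

end
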